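(* For every negation normal form $A$, the formula $\mathrm{CNFtoPropF}(\mathrm{MakeCNF}(A))\to\mathrm{NNFtoPropF}(A)$ is provable in natural deduction, i.e. $[\,]\vdash\mathrm{CNFtoPropF}(\mathrm{MakeCNF}(A))\to\mathrm{NNFtoPropF}(A)$.
   Context: Fix a set $V$ of propositional variables with decidable equality. Formulas are generated by $\#p$ ($p\in V$), $\bot$, $A\wedge B$, $A\vee B$, $A\to B$; $\neg A:=A\to\bot$, $\top:=\neg\bot$. Contexts are finite lists of formulas, $A::\Gamma$ prepends $A$, $[\,]$ is the empty list. Natural deduction $\Gamma\vdash A$ is the least relation closed under: (Ax) $A$ in $\Gamma$ implies $\Gamma\vdash A$; ($\to$I) $A::\Gamma\vdash B$ implies $\Gamma\vdash A\to B$; ($\to$E) $\Gamma\vdash A\to B$ and $\Gamma\vdash A$ imply $\Gamma\vdash B$; ($\bot_c$) $\neg A::\Gamma\vdash\bot$ implies $\Gamma\vdash A$; ($\wedge$I) $\Gamma\vdash A$, $\Gamma\vdash B$ imply $\Gamma\vdash A\wedge B$; ($\wedge$E$_{1,2}$) $\Gamma\vdash A\wedge B$ implies $\Gamma\vdash A$ and $\Gamma\vdash B$; ($\vee$I$_{1,2}$) $\Gamma\vdash A$ or $\Gamma\vdash B$ implies $\Gamma\vdash A\vee B$; ($\vee$E) $\Gamma\vdash A\vee B$, $A::\Gamma\vdash C$, $B::\Gamma\vdash C$ imply $\Gamma\vdash C$. The type NNF is generated by $\mathrm{NPos}(p)$, $\mathrm{NNeg}(p)$ ($p\in V$), $\mathrm{NBot}$,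 $\mathrm{NTop}$, $\mathrm{NConj}(X,Y)$, $\mathrm{NDisj}(X,Y)$; $\mathrm{NNFtoPropF}$ sends these to $\#p$, $\neg\#p$, $\bot$, $\top$, $X'\wedge Y'$, $X'\vee Y'$. Literals are $\mathrm{LPos}(p)$, $\mathrm{LNeg}(p)$, $\mathrm{LBot}$, $\mathrm{LTop}$, mapped to $\#p,\neg\#p,\bot,\top$. A clause is a finite list of literals; a CNF is a finite list of clauses. $\mathrm{ClausetoPropF}([\,])=\bot$, $\mathrm{ClausetoPropF}(l::c)=l'\vee\mathrm{ClausetoPropF}(c)$; $\mathrm{CNFtoPropF}([\,])=\top$, $\mathrm{CNFtoPropF}(c::ll)=\mathrm{ClausetoPropF}(c)\wedge\mathrm{CNFtoPropF}(ll)$. $\mathrm{AddClause}(c,ll)$ replaces each clause $c_2$ of $ll$ by $c\mathbin{++}c_2$; $\mathrm{Disjunct}(ll_1,ll_2)$ is the concatenation over clauses $c$ of $ll_1$ (in order) of $\mathrm{AddClause}(c,ll_2)$. $\mathrm{MakeCNF}$: $\mathrm{NPos}(p)\mapsto[[\mathrm{LPos}(p)]]$, $\mathrm{NNeg}(p)\mapsto[[\mathrm{LNeg}(p)]]$, $\mathrm{NBot}\mapsto[[\mathrm{LBot}]]$, $\mathrm{NTop}\mapsto[[\mathrm{LTop}]]$, $\mathrm{NConj}(B,C)\mapsto\mathrm{MakeCNF}(B)\mathbin{++}\mathrm{MakeCNF}(C)$, $\mathrm{NDisj}(B,C)\mapsto\mathrm{Disjunct}(\mathrm{MakeCNF}(B),\mathrm{MakeCNF}(C))$.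 *)

theory Defs
  imports Main
begin

datatype 'v PropF =
    Var 'v  ("#_" [100] 100)
  | Bot  ("\<bottom>\<^sub>P")
  | Conj "'v PropF" "'v PropF"  (infixr "\<and>\<^sub>P" 65)
  | Disj "'v PropF" "'v PropF"  (infixr "\<or>\<^sub>P" 60)
  | Impl "'v PropF" "'v PropF"  (infixr "\<rightarrow>\<^sub>P" 55)

abbreviation Neg :: "'v PropF \<Rightarrow> 'v PropF"  ("\<not>\<^sub>P _" [80] 80)
  where "\<not>\<^sub>P A \<equiv> A \<rightarrow>\<^sub>P \<bottom>\<^sub>P"

abbreviation Top :: "'v PropF"  ("\<top>\<^sub>P")
  where "\<top>\<^sub>P \<equiv> \<not>\<^sub>P \<bottom>\<^sub>P"

inductive Nc :: "'v PropF list \<Rightarrow> 'v PropF \<Rightarrow> bool"  (infix "\<turnstile>" 50) where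
  Nax: "A \<in> set \<Gamma> \<Longrightarrow> \<Gamma> \<turnstile> A"
| NImpI: "A # \<Gamma> \<turnstile> B \<Longrightarrow> \<Gamma> \<turnstile> A \<rightarrow>\<^sub>P B"
| NImpE: "\<Gamma> \<turnstile> A \<rightarrow>\<^sub>P B \<Longrightarrow> \<Gamma> \<turnstile> A \<Longrightarrow> \<Gamma> \<turnstile> B"
| NBotC: "\<not>\<^sub>P A # \<Gamma> \<turnstile> \<bottom>\<^sub>P \<Longrightarrow> \<Gamma> \<turnstile> A"
| NConjI: "\<Gamma> \<turnstile> A \<Longrightarrow> \<Gamma> \<turnstile> B \<Longrightarrow> \<Gamma> \<turnstile> A \<and>\<^sub>P B"
| NConjE1: "\<Gamma> \<turnstile> A \<and>\<^sub>P B \<Longrightarrow> \<Gamma> \<turnstile> A"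
| NConjE2: "\<Gamma> \<turnstile> A \<and>\<^sub>P B \<Longrightarrow> \<Gamma> \<turnstile> B"
| NDisjI1: "\<Gamma> \<turnstile> A \<Longrightarrow> \<Gamma> \<turnstile> A \<or>\<^sub>P B"
| NDisjI2: "\<Gamma> \<turnstile> B \<Longrightarrow> \<Gamma> \<turnstile> A \<or>\<^sub>P B"
| NDisjE: "\<Gamma> \<turnstile> A \<or>\<^sub>P B \<Longrightarrow> A # \<Gamma> \<turnstile> C \<Longrightarrow> B # \<Gamma> \<turnstile> C \<Longrightarrow> \<Gamma> \<turnstile> C"

datatype 'v NNF =
    NPos 'v
  | NNeg 'v
  | NBot
  | NTop
  | NConj "'v NNF" "'v NNF"
  | NDisj "'v NNF" "'v NNF"

primrec NNFtoPropF :: "'v NNF \<Rightarrow> 'v PropF" where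
  "NNFtoPropF (NPos p) = #p"
| "NNFtoPropF (NNeg p) = \<not>\<^sub>P #p"
| "NNFtoPropF NBot = \<bottom>\<^sub>P"
| "NNFtoPropF NTop = \<top>\<^sub>P"
| "NNFtoPropF (NConj X Y) = NNFtoPropF X \<and>\<^sub>P NNFtoPropF Y"
| "NNFtoPropF (NDisj X Y) = NNFtoPropF X \<or>\<^sub>P NNFtoPropF Y"

datatype 'v Literal =
    LPos 'v
  | LNeg 'v
  | LBot
  | LTop

type_synonym 'v Clause = "'v Literal list"
type_synonym 'v CNF = "'v Clause list"

primrec LiteraltoPropF :: "'v Literal \<Rightarrow> 'v PropF" where
  "LiteraltoPropF (LPos p) = #p"
| "LiteraltoPropF (LNeg p) = \<not>\<^sub>P #p"
| "LiteraltoPropF LBot = \<bottom>\<^sub>P"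
| "LiteraltoPropF LTop = \<top>\<^sub>P"

primrec ClausetoPropF :: "'v Clause \<Rightarrow> 'v PropF" where
  "ClausetoPropF [] = \<bottom>\<^sub>P"
| "ClausetoPropF (l # c) = LiteraltoPropF l \<or>\<^sub>P ClausetoPropF c"

primrec CNFtoPropF :: "'v CNF \<Rightarrow> 'v PropF" where
  "CNFtoPropF [] = \<top>\<^sub>P"
| "CNFtoPropF (c # ll) = ClausetoPropF c \<and>\<^sub>P CNFtoPropF ll"

definition AddClause :: "'v Clause \<Rightarrow> 'v CNF \<Rightarrow> 'v CNF" where
  "AddClause c ll = map (\<lambda>c2. c @ c2) ll"

definition Disjunct :: "'v CNF \<Rightarrow> 'v CNF \<Rightarrow> 'v CNF" where
  "Disjunct ll1 ll2 = concat (map (\<lambda>c. AddClause c ll2) ll1)"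

primrec MakeCNF :: "'v NNF \<Rightarrow> 'v CNF" where
  "MakeCNF (NPos p) = [[LPos p]]"
| "MakeCNF (NNeg p) = [[LNeg p]]"
| "MakeCNF NBot = [[LBot]]"
| "MakeCNF NTop = [[LTop]]"
| "MakeCNF (NConj B C) = MakeCNF B @ MakeCNF C"
| "MakeCNF (NDisj B C) = Disjunct (MakeCNF B) (MakeCNF C)"

end

theory Submission
  imports Defs
begin

text \<open>By induction on \<open>A\<close>, derivability of the normal form in any context is
  turned into derivability of the original formula. The only real case is disjunction, where
  \<open>Disjunct\<close> has multiplied out by the distributive law, and this must be undone: from
  all \<open>c \<or> d\<close>, with \<open>c\<close> in the first CNF and \<open>d\<close> in the
  second, recover the disjunction of the two conjunctions. \<open>Nc_AddClause\<close> factors out a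
  fixed \<open>c\<close>, and \<open>Nc_Disjunct\<close> then factors out the whole second
  CNF.\<close>

text \<open>Set inclusion, unlike extension at the head, is preserved when a rule that discharges a
  hypothesis puts it in front of both contexts.\<close>

lemma Nc_weaken: "\<Gamma> \<turnstile> A \<Longrightarrow> set \<Gamma> \<subseteq> set \<Delta> \<Longrightarrow> \<Delta> \<turnstile> A"
proof (induction arbitrary: \<Delta> rule: Nc.induct)
  case (NImpI A \<Gamma> B)
  have "A # \<Delta> \<turnstile> B"
    using NImpI.prems by (intro NImpI.IH) auto
  then show ?case
    by (rule Nc.NImpI)
next
  case (NBotC A \<Gamma>)
  have "\<not>\<^sub>P A # \<Delta> \<turnstile> \<bottom>\<^sub>P"
    using NBotC.prems by (intro NBotC.IH) auto
  then show ?case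
    by (rule Nc.NBotC)
next
  case (NDisjE \<Gamma> A B C)
  have "\<Delta> \<turnstile> A \<or>\<^sub>P B"
    using NDisjE.prems by (rule NDisjE.IH)
  moreover have "A # \<Delta> \<turnstile> C"
    using NDisjE.prems by (intro NDisjE.IH(2)) auto
  moreover have "B # \<Delta> \<turnstile> C"
    using NDisjE.prems by (intro NDisjE.IH(3)) auto
  ultimately show ?case
    by (rule Nc.NDisjE)
next
  case (NImpE \<Gamma> A B)
  then show ?case
    by (meson Nc.NImpE)
qed (auto intro: Nax NConjI NConjE1 NConjE2 NDisjI1 NDisjI2)

lemma Nc_weaken_Cons: "\<Gamma> \<turnstile> A \<Longrightarrow> B # \<Gamma> \<turnstile> A"
  by (erule Nc_weaken) auto

lemma Nc_hd: "A # \<Gamma> \<turnstile> A"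
  by (simp add: Nax)

lemma Nc_botE: "\<Gamma> \<turnstile> \<bottom>\<^sub>P \<Longrightarrow> \<Gamma> \<turnstile> A"
  by (rule NBotC) (rule Nc_weaken_Cons)

lemma Nc_top: "\<Gamma> \<turnstile> \<top>\<^sub>P"
  by (intro NImpI Nc_hd)

lemma Nc_disj_bot: "\<Gamma> \<turnstile> A \<or>\<^sub>P \<bottom>\<^sub>P \<Longrightarrow> \<Gamma> \<turnstile> A"
  by (erule NDisjE) (auto intro: Nc_hd Nc_botE)

lemma Nc_disj_mono:
  "\<Gamma> \<turnstile> A \<or>\<^sub>P B \<Longrightarrow> A # \<Gamma> \<turnstile> A' \<Longrightarrow> B # \<Gamma> \<turnstile> B' \<Longrightarrow> \<Gamma> \<turnstile> A' \<or>\<^sub>P B'"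
  by (erule NDisjE) (auto intro: NDisjI1 NDisjI2)

lemma Nc_disj_assoc: "\<Gamma> \<turnstile> A \<or>\<^sub>P (B \<or>\<^sub>P C) \<Longrightarrow> \<Gamma> \<turnstile> (A \<or>\<^sub>P B) \<or>\<^sub>P C"
proof (erule NDisjE)
  show "(B \<or>\<^sub>P C) # \<Gamma> \<turnstile> (A \<or>\<^sub>P B) \<or>\<^sub>P C"
    by (rule Nc_disj_mono[OF Nc_hd]) (intro NDisjI2 Nc_hd, rule Nc_hd)
qed (intro NDisjI1 Nc_hd)

lemma Nc_disj_conj_distrib:
  assumes "\<Gamma> \<turnstile> A \<or>\<^sub>P B" "\<Gamma> \<turnstile> A \<or>\<^sub>P C"
  shows "\<Gamma> \<turnstile> A \<or>\<^sub>P (B \<and>\<^sub>P C)"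
  using assms(1)
proof (rule NDisjE)
  show "B # \<Gamma> \<turnstile> A \<or>\<^sub>P (B \<and>\<^sub>P C)"
    using assms(2)[THEN Nc_weaken_Cons, of B]
    by (rule Nc_disj_mono) (simp_all add: Nax NConjI)
qed (intro NDisjI1 Nc_hd)

lemma Nc_conj_disj_distrib:
  assumes "\<Gamma> \<turnstile> A \<or>\<^sub>P C" "\<Gamma> \<turnstile> B \<or>\<^sub>P C"
  shows "\<Gamma> \<turnstile> (A \<and>\<^sub>P B) \<or>\<^sub>P C"
  using assms(1)
proof (rule NDisjE)
  show "A # \<Gamma> \<turnstile> (A \<and>\<^sub>P B) \<or>\<^sub>P C"
    using assms(2)[THEN Nc_weaken_Cons, of A]
    by (rule Nc_disj_mono) (simp_all add: Nax NConjI)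
qed (intro NDisjI2 Nc_hd)

text \<open>Reduces concatenation of CNFs to union of clause sets, so that nested object-level
  conjunctions need not be rearranged.\<close>

lemma Nc_CNF_iff: "\<Gamma> \<turnstile> CNFtoPropF ll \<longleftrightarrow> (\<forall>c\<in>set ll. \<Gamma> \<turnstile> ClausetoPropF c)"
  by (induction ll) (auto intro: Nc_top NConjI dest: NConjE1 NConjE2)

lemma Nc_Clause_append:
  "\<Gamma> \<turnstile> ClausetoPropF (c @ d) \<Longrightarrow> \<Gamma> \<turnstile> ClausetoPropF c \<or>\<^sub>P ClausetoPropF d"
proof (induction c arbitrary: \<Gamma>)
  case Nil
  then show ?case
    by (simp add: NDisjI2)
next
  case (Cons l c)
  then have "\<Gamma> \<turnstile> LiteraltoPropF l \<or>\<^sub>P ClausetoPropF (c @ d)"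
    by simp
  then have "\<Gamma> \<turnstile> LiteraltoPropF l \<or>\<^sub>P (ClausetoPropF c \<or>\<^sub>P ClausetoPropF d)"
    \<comment> \<open>The induction hypothesis is applied below the second disjunct, in an extended
      context; hence the generalisation over \<open>\<Gamma>\<close>.\<close>
    by (rule Nc_disj_mono) (intro Cons.IH Nc_hd)+
  then show ?case
    by (simp add: Nc_disj_assoc)
qed

text \<open>Every clause \<open>c @ c2\<close> splits into a disjunction with the common left part
  \<open>c\<close>, which is factored out one clause at a time; for empty \<open>ll\<close> the
  right disjunct is \<open>Top\<close>.\<close>

lemma Nc_AddClause:
  "\<Gamma> \<turnstile> CNFtoPropF (AddClause c ll) \<Longrightarrow> \<Gamma> \<turnstile> ClausetoPropF c \<or>\<^sub>P CNFtoPropF ll"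
  unfolding Nc_CNF_iff AddClause_def
  by (induction ll)
    (auto intro: NDisjI2 Nc_top Nc_disj_conj_distrib Nc_Clause_append)

lemma Nc_Disjunct:
  "\<Gamma> \<turnstile> CNFtoPropF (Disjunct ll1 ll2) \<Longrightarrow> \<Gamma> \<turnstile> CNFtoPropF ll1 \<or>\<^sub>P CNFtoPropF ll2"
proof (induction ll1)
  case Nil
  show ?case
    by (simp add: NDisjI1 Nc_top)
next
  case (Cons c ll1)
  then have "\<Gamma> \<turnstile> CNFtoPropF (AddClause c ll2)" "\<Gamma> \<turnstile> CNFtoPropF (Disjunct ll1 ll2)"
    by (auto simp: Nc_CNF_iff Disjunct_def)
  \<comment> \<open>Both facts yield disjunctions with right part \<open>CNFtoPropF ll2\<close>, the
    first with left part \<open>c\<close>, the second with left part \<open>ll1\<close>; this common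
    right part is factored out.\<close>
  then show ?case
    by (auto intro: Nc_conj_disj_distrib Nc_AddClause Cons.IH)
qed

text \<open>The context is arbitrary because a disjunction is handled by cases, each induction
  hypothesis being used under its own disjunct as assumption.\<close>

lemma Nc_MakeCNF_imp_NNF: "\<Gamma> \<turnstile> CNFtoPropF (MakeCNF A) \<Longrightarrow> \<Gamma> \<turnstile> NNFtoPropF A"
proof (induction A arbitrary: \<Gamma>)
  case (NConj B C)
  then show ?case
    by (auto simp: Nc_CNF_iff intro: NConjI)
next
  case (NDisj B C)
  then have "\<Gamma> \<turnstile> CNFtoPropF (MakeCNF B) \<or>\<^sub>P CNFtoPropF (MakeCNF C)"
    by (auto intro: Nc_Disjunct)
  then show ?case
    unfolding NNFtoPropF.simps by (rule Nc_disj_mono) (intro NDisj.IH Nc_hd)+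
\<comment> \<open>For a literal \<open>l\<close> the CNF unfolds to \<open>l \<or> \<bottom>\<close>
  in conjunction with \<open>Top\<close>.\<close>
qed (auto intro: Nc_disj_bot NConjE1)

theorem mainTheorem7:
  fixes A :: "'v NNF"
  shows "[] \<turnstile> CNFtoPropF (MakeCNF A) \<rightarrow>\<^sub>P NNFtoPropF A"
  by (intro NImpI Nc_MakeCNF_imp_NNF Nc_hd)

end
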